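(* Let $p$ be a prime, $r,n$ positive integers, $q=p^r$ and $d=\gcd(n+1,p-1)$. Let $\gamma$ be a primitive element of $\mathbb{F}_q$ (a generator of $\mathbb{F}_q^*$). Let $e>1$ be a divisor of $\gcd\left(\tfrac{p-1}{d},r\right)$, and let $a\in\mathbb{F}_q$. If there exist a positive divisor $t$ of $\tfrac{r}{e}$ and $u\in\{1,\ldots,e-1\}$ with $\gcd(e,u)=1$ such that $a\in\sqrt[e]{\gamma_t}^{\,u}\,\mathbb{F}_{p^t}^*$, where $$\sqrt[e]{\gamma_t}:=\gamma^{\frac{p^r-1}{e(p^t-1)}}$$ is an $e$th root of the primitive element $\gamma_t:=\gamma^{(p^r-1)/(p^t-1)}$ of $\mathbb{F}_{p^t}$, then $\mathrm{Kl}_n(q,a)\in E_{de}$.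
   Context: $\mathbb{F}_q$ is the finite field with $q=p^r$ elements, and for $t\mid r$, $\mathbb{F}_{p^t}$ is regarded as a subfield of $\mathbb{F}_q$. $\mathrm{Tr}:\mathbb{F}_q\to\mathbb{F}_p$ is the absolute trace, $\zeta_p=e^{2\pi \mathrm{i}/p}$, and $\psi(x)=\zeta_p^{\mathrm{Tr}(x)}$ for $x\in\mathbb{F}_q$. The $n$-dimensional Kloosterman sum at $a\in\mathbb{F}_q$ is $$\mathrm{Kl}_n(q,a)=\sum_{x_1,\ldots,x_n\in\mathbb{F}_q^*}\psi\left(x_1+x_2+\cdots+x_n+\frac{a}{x_1x_2\cdots x_n}\right)\in\mathbb{Q}(\zeta_p).$$ For a positive divisor $m$ of $p-1$, $E_m$ denotes the unique intermediate field $\mathbb{Q}\subseteq E_m\subseteq\mathbb{Q}(\zeta_p)$ of degree $\tfrac{p-1}{m}$ over $\mathbb{Q}$, i.e. the fixed field of the unique subgroup of order $m$ of the cyclic group $\mathrm{Gal}(\mathbb{Q}(\zeta_p)/\mathbb{Q})\cong\mathbb{F}_p^*$. *)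

theory Defs
  imports
    Complex_Main
    "HOL-Library.FuncSet"
    "HOL-Library.Cardinality"
    "HOL-Computational_Algebra.Primes"
    "HOL-Algebra.Generated_Fields"
    "HOL-Algebra.Bij"
    "HOL-Algebra.Algebraic_Closure_Type"
begin

section \<open>Kloosterman sums over finite fields\<close>

text \<open>
  The field with \<open>q = p ^ r\<close> elements is a type \<^typ>\<open>'a\<close> of class \<^class>\<open>finite_field\<close> with
  \<open>CARD('a) = p ^ r\<close>; the functions below are meant for these \<open>p\<close> and \<open>r\<close> only.
\<close>

definition abs_trace :: "nat \<Rightarrow> nat \<Rightarrow> 'a::finite_field \<Rightarrow> 'a" where
  "abs_trace p r x = (\<Sum>i<r. x ^ (p ^ i))"

definition zeta :: "nat \<Rightarrow> complex" where
  "zeta p = exp (2 * of_real pi * \<i> / of_nat p)"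

text \<open>
  The trace lies in the prime field, that is, among the \<^term>\<open>of_nat k\<close> with \<open>k < p\<close>. The
  exponent of \<^term>\<open>zeta p\<close> is the representative \<open>k\<close>.
\<close>

definition add_char :: "nat \<Rightarrow> nat \<Rightarrow> 'a::finite_field \<Rightarrow> complex" where
  "add_char p r x = zeta p ^ (THE k. k < p \<and> of_nat k = abs_trace p r x)"

definition kloosterman :: "nat \<Rightarrow> nat \<Rightarrow> nat \<Rightarrow> 'a::finite_field \<Rightarrow> complex" where
  "kloosterman p r n a =
     (\<Sum>x \<in> {1..n} \<rightarrow>\<^sub>E (UNIV - {0}). add_char p r ((\<Sum>i=1..n. x i) + a / (\<Prod>i=1..n. x i)))"

definition primitive_element :: "'a::finite_field \<Rightarrow> bool" where
  "primitive_element g \<longleftrightarrow> range (\<lambda>k::nat. g ^ k) = UNIV - {0}"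

section \<open>Subfields of the cyclotomic field\<close>

definition cyclotomic_field :: "nat \<Rightarrow> complex set" where
  "cyclotomic_field p = generate_field ring_of_type_algebra {zeta p}"

text \<open>
  As in \<^const>\<open>AutoGroup\<close>, automorphisms are extensional functions on the field, so that equal
  automorphisms are equal functions.
\<close>

definition galois_group :: "nat \<Rightarrow> (complex \<Rightarrow> complex) monoid" where
  "galois_group p =
     (let K = cyclotomic_field p; R = ring_of_type_algebra\<lparr>carrier := K\<rparr>
      in BijGroup K \<lparr>carrier := {\<sigma> \<in> Bij K. \<sigma> \<in> ring_hom R R \<and> (\<forall>x\<in>\<rat>. \<sigma> x = x)}\<rparr>)"

text \<open>
  For prime \<open>p\<close> the Galois group is cyclic of order \<open>p - 1\<close>, so for \<open>m\<close> dividing \<open>p - 1\<close> it has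
  exactly one subgroup of order \<open>m\<close>; the fixed field of this subgroup has degree \<open>(p - 1) / m\<close>
  over the rationals.
\<close>

definition cyclotomic_subfield :: "nat \<Rightarrow> nat \<Rightarrow> complex set" where
  "cyclotomic_subfield p m =
     (let H = (THE H. subgroup H (galois_group p) \<and> card H = m)
      in {x \<in> cyclotomic_field p. \<forall>\<sigma>\<in>H. \<sigma> x = x})"

end

theory Submission
  imports Defs "HOL-Number_Theory.Residue_Primitive_Roots"
begin

text \<open>
  Let \<open>\<zeta> = zeta p\<close>, and for \<open>w\<close> prime to \<open>p\<close> let \<open>\<sigma>\<^sub>w\<close> be the automorphism of \<open>\<rat>(\<zeta>)\<close> with
  \<open>\<sigma>\<^sub>w(\<zeta>) = \<zeta>\<^sup>w\<close>. Two symmetries of the Kloosterman sums \<open>Kl(a)\<close> meet in the theorem.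
  
  Applying \<open>\<sigma>\<^sub>w\<close> multiplies the argument of the additive character by the element \<open>c\<close> of the prime
  field represented by \<open>w\<close>. Substituting \<open>x\<^sub>i / c\<close> for each \<open>x\<^sub>i\<close> turns the sum \<open>c * x\<^sub>1 + \<dots> + c * x\<^sub>n\<close>
  back into \<open>x\<^sub>1 + \<dots> + x\<^sub>n\<close> and collects all factors \<open>c\<close> in the last term, so
  \<open>\<sigma>\<^sub>w(Kl(a)) = Kl(c\<^bsup>n+1\<^esup> * a)\<close> (\<open>zeta_conj_kloosterman\<close>). On the other hand the trace is invariant
  under the Frobenius map, so substituting \<open>x\<^sub>i\<^sup>p\<close> for \<open>x\<^sub>i\<close> gives \<open>Kl(a\<^sup>p) = Kl(a)\<close>
  (\<open>kloosterman_frobenius\<close>).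
  
  Now let \<open>a = \<theta>\<^sup>u * b\<close>, where \<open>\<theta>\<close> is the given \<open>e\<close>-th root of \<open>\<gamma>\<^sub>t\<close> and \<open>b\<close> is a nonzero element of the
  field with \<open>Q = p\<^sup>t\<close> elements. Then \<open>b\<^bsup>Q-1\<^esup> = 1\<close>, whereas \<open>\<eta> = \<theta>\<^bsup>u(Q-1)\<^esup>\<close> is a primitive \<open>e\<close>-th root of
  unity because \<open>u\<close> is prime to \<open>e\<close>. Hence \<open>a\<^sup>Q = \<eta> * a\<close>. Since \<open>e\<close> divides \<open>p - 1\<close>, raising to the
  \<open>Q\<close>-th power fixes \<open>\<eta>\<close>, and iterating it multiplies \<open>a\<close> by any prescribed power of \<open>\<eta>\<close>; so
  \<open>Kl\<close> does not distinguish \<open>a\<close> from \<open>\<eta>\<^sup>j * a\<close> (\<open>kloosterman_root_of_unity_twist\<close>). If \<open>w\<close> has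
  \<open>w\<^bsup>de\<^esup> = 1\<close> modulo \<open>p\<close>, then \<open>c\<^bsup>n+1\<^esup>\<close> is an \<open>e\<close>-th root of unity, because \<open>d\<close> divides \<open>n + 1\<close>; it
  is therefore a power of \<open>\<eta>\<close>, and \<open>\<sigma>\<^sub>w\<close> fixes \<open>Kl(a)\<close>.
  
  It remains to know that these \<open>\<sigma>\<^sub>w\<close> are exactly the subgroup of order \<open>d * e\<close>
  (\<open>cyclotomic_subfield_iff\<close>). Uniqueness of the subgroup holds because the Galois group embeds into the
  cyclic group of units modulo \<open>p\<close>. Its existence requires all the \<open>\<sigma>\<^sub>w\<close> to exist, that is, an integer
  polynomial vanishing at \<open>\<zeta>\<close> must vanish at \<open>\<zeta>\<^sup>w\<close> (\<open>int_eval_zeta_power_eq_0\<close>). This is the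
  irreducibility of the cyclotomic polynomial, which Eisenstein's criterion gives after the shift
  by \<open>1\<close>.
\<close>

section \<open>Integer polynomials with a common root\<close>

definition int_eval :: "int poly \<Rightarrow> 'a::idom \<Rightarrow> 'a" where
  "int_eval f z = poly (map_poly of_int f) z"

lemma int_eval_0 [simp]: "int_eval 0 z = 0"
  by (simp add: int_eval_def)

lemma int_eval_pCons [simp]: "int_eval (pCons c f) z = of_int c + z * int_eval f z"
  by (simp add: int_eval_def map_poly_pCons)

lemma int_eval_1 [simp]: "int_eval 1 z = 1"
  by (simp add: one_pCons)

lemma int_eval_add [simp]: "int_eval (f + g) z = int_eval f z + int_eval g z"
  by (induction f g rule: poly_induct2) (simp_all add: algebra_simps)

lemma int_eval_minus [simp]: "int_eval (- f) z = - int_eval f z"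
  by (induction f) (simp_all add: algebra_simps)

lemma int_eval_diff [simp]: "int_eval (f - g) z = int_eval f z - int_eval g z"
  by (simp only: diff_conv_add_uminus int_eval_add int_eval_minus)

lemma int_eval_smult [simp]: "int_eval (smult c f) z = of_int c * int_eval f z"
  by (induction f) (simp_all add: algebra_simps)

lemma int_eval_mult [simp]: "int_eval (f * g) z = int_eval f z * int_eval g z"
  by (induction f) (simp_all add: algebra_simps)

lemma int_eval_sum [simp]: "int_eval (\<Sum>i\<in>A. f i) z = (\<Sum>i\<in>A. int_eval (f i) z)"
  by (induction A rule: infinite_finite_induct) simp_all

lemma int_eval_monom [simp]: "int_eval (monom c n) z = of_int c * z ^ n"
  by (simp add: int_eval_def map_poly_monom poly_monom)

lemma int_eval_pcompose [simp]: "int_eval (f \<circ>\<^sub>p g) z = int_eval f (int_eval g z)"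
  by (induction f) (simp_all add: pcompose_pCons)

text \<open>
  A primitive nonzero integer polynomial of least degree among those vanishing at \<open>z\<close> divides all of
  them: pseudo-division leaves no remainder, and by Gauss's lemma the factor introduced by pseudo-division
  cancels against the content of the quotient. An irreducible \<open>F\<close> with root \<open>z\<close> is an associate of that
  polynomial.
\<close>

lemma irreducible_int_poly_dvd_if_common_root:
  fixes F f :: "int poly" and z :: "'a::{idom,ring_char_0}"
  assumes irr: "irreducible F" and F: "int_eval F z = 0" and f: "int_eval f z = 0"
  shows "F dvd f"
proof -
  have "F \<noteq> 0" using irr by auto
  define P where "P = (\<lambda>g::int poly. g \<noteq> 0 \<and> int_eval g z = 0)"
  have "P F" using \<open>F \<noteq> 0\<close> F by (simp add: P_def)
  then obtain g0 where g0: "P g0" and min: "\<And>h. P h \<Longrightarrow> degree g0 \<le> degree h"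
    using ex_has_least_nat[of P F degree] by blast
  define g where "g = primitive_part g0"
  have g: "g \<noteq> 0" "content g = 1" "degree g = degree g0"
    using g0 by (auto simp: g_def P_def)
  have "of_int (content g0) * int_eval g z = int_eval (smult (content g0) g) z"
    by simp
  also have "\<dots> = 0" using g0 by (simp add: g_def P_def)
  finally have gz: "int_eval g z = 0" using g0 by (auto simp: P_def)
  have dvd: "g dvd h" if h: "int_eval h z = 0" for h
  proof -
    obtain c q where c: "c \<noteq> 0" "smult c h = g * q + pseudo_mod h g"
      using pseudo_mod(1)[OF g(1)] by blast
    have "int_eval (pseudo_mod h g) z = int_eval (smult c h - g * q) z"
      using c(2) by (simp add: algebra_simps)
    also have "\<dots> = 0" using h gz by simp
    finally have r: "int_eval (pseudo_mod h g) z = 0" .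
    have "pseudo_mod h g = 0"
    proof (rule ccontr)
      assume nz: "pseudo_mod h g \<noteq> 0"
      then have "degree (pseudo_mod h g) < degree g0"
        using pseudo_mod(2)[OF g(1), of h] g(3) by auto
      moreover have "P (pseudo_mod h g)" using nz r by (simp add: P_def)
      ultimately show False using min by (simp add: leD)
    qed
    with c have eq: "smult c h = g * q" by simp
    then have "content (smult c h) = content (g * q)" by simp
    \<comment> \<open>Gauss's lemma: contents are multiplicative and \<open>g\<close> is primitive.\<close>
    then have "normalize c * content h = content q" using g(2) by (simp add: content_mult)
    then have "c dvd content q" by (metis dvd_triv_left normalize_dvd_iff)
    then have "[:c:] dvd q" by (simp add: const_poly_dvd_iff_dvd_content)
    then obtain q' where "q = smult c q'" by (auto elim!: dvdE)
    with eq have "smult c (h - g * q') = 0" by (simp add: smult_diff_right)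
    with c(1) have "h = g * q'" by simp
    then show ?thesis by simp
  qed
  obtain h where h: "F = g * h" using dvd[OF F] by (auto elim: dvdE)
  have "\<not> is_unit g"
    using gz by (auto simp: is_unit_poly_iff)
  then have "is_unit h" using irr h by (auto dest: irreducibleD)
  then have "F dvd g" unfolding h by (simp add: mult_unit_dvd_iff)
  then show ?thesis using dvd[OF f] by (rule dvd_trans)
qed

text \<open>
  In a factorization \<open>F = G * H\<close> exactly one constant coefficient, say that of \<open>H\<close>, is divisible by \<open>p\<close>.
  The leading coefficient of \<open>H\<close> is not. At the first index \<open>i\<close> with \<open>p\<close> not dividing the \<open>i\<close>-th
  coefficient of \<open>H\<close>, that of the product \<open>F\<close> is prime to \<open>p\<close> as well. Hence \<open>i\<close> is the degree of
  \<open>F\<close>, and \<open>G\<close> is constant; since \<open>F\<close> is primitive, \<open>G\<close> is a unit.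
\<close>

lemma eisenstein:
  fixes F :: "int poly" and p :: int
  assumes p: "prime p" and deg: "degree F > 0" and prim: "content F = 1"
    and low: "\<And>i. i < degree F \<Longrightarrow> p dvd coeff F i"
    and const: "\<not> p\<^sup>2 dvd coeff F 0"
  shows "irreducible F"
proof (rule irreducibleI)
  show "F \<noteq> 0" using deg by auto
  show "\<not> is_unit F" using deg by (auto simp: is_unit_poly_iff)
  have lead: "\<not> p dvd lead_coeff F"
  proof
    assume "p dvd lead_coeff F"
    then have "p dvd coeff F i" for i
      using low[of i] by (cases i "degree F" rule: linorder_cases) (auto simp: coeff_eq_0)
    then have "[:p:] dvd F" by (simp add: const_poly_dvd_iff)
    then have "p dvd 1" using prim by (metis const_poly_dvd_iff_dvd_content)
    then show False using p by auto
  qed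
  have key: False
    if GH: "F = G * H" and H: "p dvd coeff H 0" "\<not> p dvd coeff G 0" "degree G > 0" for G H
  proof -
    have lc: "\<not> p dvd lead_coeff H" using lead GH by (auto simp: lead_coeff_mult)
    define i where "i = (LEAST i. \<not> p dvd coeff H i)"
    have i: "\<not> p dvd coeff H i" unfolding i_def using lc by (rule LeastI)
    have less: "p dvd coeff H j" if "j < i" for j
      using that not_less_Least unfolding i_def by blast
    have "i \<le> degree H" using lc unfolding i_def by (rule Least_le)
    moreover have "degree F = degree G + degree H"
      using GH \<open>F \<noteq> 0\<close> by (auto intro: degree_mult_eq)
    ultimately have "p dvd coeff F i" using low H(3) by auto
    moreover have "coeff F i = coeff G 0 * coeff H i + (\<Sum>k\<in>{1..i}. coeff G k * coeff H (i - k))"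
      unfolding GH coeff_mult by (simp add: sum.atLeast_Suc_atMost atMost_atLeast0)
    moreover have "p dvd (\<Sum>k\<in>{1..i}. coeff G k * coeff H (i - k))"
      by (intro dvd_sum dvd_mult less) auto
    ultimately have "p dvd coeff G 0 * coeff H i" by (simp add: dvd_add_left_iff)
    then show False using p i H(2) by (simp add: prime_dvd_mult_iff)
  qed
  have unit: "is_unit G" if GH: "F = G * H" and G: "degree G = 0" for G H
  proof -
    obtain c where c: "G = [:c:]" using G degree_eq_zeroE by blast
    then have "[:c:] dvd F" using GH by (metis dvd_triv_left)
    then have "c dvd 1" using prim by (metis const_poly_dvd_iff_dvd_content)
    then show ?thesis using c by (simp add: is_unit_poly_iff)
  qed
  fix G H assume GH: "F = G * H"
  have c0: "coeff F 0 = coeff G 0 * coeff H 0" using GH by (simp add: coeff_mult)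
  then have "p dvd coeff G 0 \<or> p dvd coeff H 0"
    using low[of 0] deg p by (simp add: prime_dvd_mult_iff)
  moreover have "\<not> (p dvd coeff G 0 \<and> p dvd coeff H 0)"
    using const c0 by (auto simp: power2_eq_square intro: mult_dvd_mono)
  ultimately have "degree G = 0 \<or> degree H = 0"
    using key[of G H] key[of H G] GH by (auto simp: mult.commute)
  then show "is_unit G \<or> is_unit H"
    using unit[of G H] unit[of H G] GH by (auto simp: mult.commute)
qed

section \<open>Powers of zeta as conjugate roots\<close>

lemma zeta_power: "zeta p ^ k = cis (2 * pi * real k / real p)"
proof -
  have "zeta p = cis (2 * pi / real p)"
    by (simp add: zeta_def cis_conv_exp mult_ac)
  then show ?thesis by (simp add: DeMoivre mult_ac)
qed

lemma zeta_power_p [simp]: "zeta p ^ p = 1"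
  by (cases "p = 0") (simp_all add: zeta_power)

lemma zeta_power_mod: "zeta p ^ (k mod p) = zeta p ^ k"
proof -
  have "zeta p ^ k = zeta p ^ (p * (k div p) + k mod p)" by simp
  also have "\<dots> = zeta p ^ (k mod p)" by (simp only: power_add power_mult zeta_power_p power_one mult_1)
  finally show ?thesis ..
qed

lemma zeta_power_eq_iff:
  assumes "p > 0"
  shows "zeta p ^ j = zeta p ^ k \<longleftrightarrow> [j = k] (mod p)"
proof
  assume "zeta p ^ j = zeta p ^ k"
  then have "zeta p ^ (j mod p) = zeta p ^ (k mod p)" by (simp add: zeta_power_mod)
  moreover have "inj_on (\<lambda>k. zeta p ^ k) {..<p}"
    using bij_betw_roots_unity[OF assms] by (simp add: bij_betw_def zeta_power)
  ultimately show "[j = k] (mod p)"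
    using assms by (auto simp: cong_def inj_on_def)
next
  assume "[j = k] (mod p)"
  then show "zeta p ^ j = zeta p ^ k" by (metis cong_def zeta_power_mod)
qed

lemma zeta_power_eq_1_iff: "p > 0 \<Longrightarrow> zeta p ^ k = 1 \<longleftrightarrow> p dvd k"
  using zeta_power_eq_iff[of p k 0] by (simp add: cong_0_iff)

lemma root_of_unity_is_zeta_power:
  assumes "p > 0" "z ^ p = 1"
  obtains k where "k < p" "z = zeta p ^ k"
proof -
  have "z \<in> (\<lambda>k. cis (2 * pi * real k / real p)) ` {..<p}"
    using bij_betw_roots_unity[OF assms(1)] assms(2) unfolding bij_betw_def by blast
  then show ?thesis using that by (auto simp: zeta_power)
qed

text \<open>
  The \<open>p\<close>-th cyclotomic polynomial for prime \<open>p\<close>, evaluated at \<open>X + 1\<close>, which is \<open>((X + 1)\<^sup>p - 1) / X\<close>.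
  The shift is what makes Eisenstein's criterion applicable: the prime divides the binomial
  coefficients.
\<close>

definition shifted_cyclotomic_poly :: "nat \<Rightarrow> int poly" where
  "shifted_cyclotomic_poly p = (\<Sum>i<p. monom (int (p choose Suc i)) i)"

lemma coeff_shifted_cyclotomic_poly:
  "coeff (shifted_cyclotomic_poly p) i = (if i < p then int (p choose Suc i) else 0)"
  by (simp add: shifted_cyclotomic_poly_def coeff_sum)

lemma int_eval_shifted_cyclotomic_poly:
  "z * int_eval (shifted_cyclotomic_poly p) z = (z + 1) ^ p - 1"
proof -
  have "(z + 1) ^ p = (\<Sum>k\<le>p. of_nat (p choose k) * z ^ k)"
    by (simp add: binomial_ring)
  also have "\<dots> = 1 + (\<Sum>i<p. of_nat (p choose Suc i) * z ^ Suc i)"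
    by (simp add: sum.atMost_shift)
  finally show ?thesis
    by (simp add: shifted_cyclotomic_poly_def sum_distrib_left mult_ac)
qed

lemma irreducible_shifted_cyclotomic_poly:
  assumes "prime p"
  shows "irreducible (shifted_cyclotomic_poly p)"
proof (rule eisenstein)
  let ?E = "shifted_cyclotomic_poly p"
  have p: "p > 1" using assms by (rule prime_gt_1_nat)
  have top: "coeff ?E (p - 1) = 1"
    using p by (simp add: coeff_shifted_cyclotomic_poly)
  have deg: "degree ?E = p - 1"
  proof (rule antisym)
    show "degree ?E \<le> p - 1"
      by (rule degree_le) (auto simp: coeff_shifted_cyclotomic_poly)
    show "p - 1 \<le> degree ?E" using top by (intro le_degree) simp
  qed
  show "prime (int p)" using assms by simp
  show "degree ?E > 0" using deg p by simp
  have "content ?E dvd coeff ?E (p - 1)" by (rule content_dvd_coeff)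
  then show "content ?E = 1"
    unfolding top by (metis is_unit_normalize normalize_content)
  show "int p dvd coeff ?E i" if "i < degree ?E" for i
  proof -
    have "p dvd p choose Suc i"
      using that deg assms by (intro dvd_choose_prime) auto
    then show ?thesis by (simp add: coeff_shifted_cyclotomic_poly)
  qed
  have "\<not> int p * int p dvd int p" using p by simp
  then show "\<not> (int p)\<^sup>2 dvd coeff ?E 0"
    using p by (simp add: coeff_shifted_cyclotomic_poly power2_eq_square)
qed

text \<open>
  All powers \<open>\<zeta>\<^sup>w\<close> with \<open>w\<close> prime to \<open>p\<close> are roots of one irreducible polynomial. It is therefore enough
  that this polynomial divides \<open>f\<close>, which follows from the single root \<open>\<zeta>\<close>.
\<close>

lemma int_eval_zeta_power_eq_0:
  assumes p: "prime p" and w: "\<not> p dvd w" and f: "int_eval f (zeta p) = 0"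
  shows "int_eval f (zeta p ^ w) = 0"
proof -
  let ?E = "shifted_cyclotomic_poly p"
  have p0: "p > 0" using p by (rule prime_gt_0_nat)
  have root: "int_eval ?E (zeta p ^ k - 1) = 0" if "\<not> p dvd k" for k
  proof -
    have "(zeta p ^ k) ^ p = (zeta p ^ p) ^ k" by (metis mult.commute power_mult)
    then have "(zeta p ^ k - 1) * int_eval ?E (zeta p ^ k - 1) = 0"
      by (simp add: int_eval_shifted_cyclotomic_poly)
    moreover have "zeta p ^ k - 1 \<noteq> 0" using zeta_power_eq_1_iff[OF p0] that by simp
    ultimately show ?thesis by simp
  qed
  have "?E dvd f \<circ>\<^sub>p [:1, 1:]"
  proof (rule irreducible_int_poly_dvd_if_common_root)
    show "irreducible ?E" using p by (rule irreducible_shifted_cyclotomic_poly)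
    show "int_eval ?E (zeta p - 1) = 0" using root[of 1] p by (auto simp: prime_nat_iff)
    show "int_eval (f \<circ>\<^sub>p [:1, 1:]) (zeta p - 1) = 0" using f by simp
  qed
  then obtain h where h: "f \<circ>\<^sub>p [:1, 1:] = ?E * h" by (auto elim: dvdE)
  have "int_eval f (zeta p ^ w) = int_eval (f \<circ>\<^sub>p [:1, 1:]) (zeta p ^ w - 1)" by simp
  also have "\<dots> = 0" using root[OF w] by (simp add: h)
  finally show ?thesis .
qed

text \<open>
  Inverses modulo \<open>p\<close> undo the passage from \<open>\<zeta>\<close> to \<open>\<zeta>\<^sup>w\<close>: they give the converse of the previous lemma
  and the inverse automorphisms.
\<close>

lemma inverse_mod_prime:
  fixes p w :: nat
  assumes p: "prime p" and w: "\<not> p dvd w"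
  obtains v where "\<not> p dvd v" "[w * v = 1] (mod p)"
proof -
  have "coprime w p" using p w by (metis coprime_commute prime_imp_coprime)
  then obtain v where v: "[w * v = 1] (mod p)"
    using cong_solve_coprime_nat[of w p] by auto
  have nv: "\<not> p dvd v"
  proof
    assume "p dvd v"
    then have "[w * v = 0] (mod p)" by (simp add: cong_0_iff)
    then have "[1 = 0] (mod p)" using v cong_sym cong_trans by blast
    then show False using p by (simp add: cong_0_iff)
  qed
  show thesis using nv v by (rule that)
qed

lemma int_eval_zeta_power_eq_0_iff:
  assumes p: "prime p" and w: "\<not> p dvd w"
  shows "int_eval f (zeta p ^ w) = 0 \<longleftrightarrow> int_eval f (zeta p) = 0"
proof
  assume 0: "int_eval f (zeta p ^ w) = 0"
  obtain v where nv: "\<not> p dvd v" and v: "[w * v = 1] (mod p)"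
    using inverse_mod_prime[OF p w] .
  \<comment> \<open>Substituting \<open>X\<^sup>w\<close> for \<open>X\<close> reduces this to the other direction, for the exponent \<open>v\<close>.\<close>
  have "int_eval (f \<circ>\<^sub>p monom 1 w) (zeta p) = 0" using 0 by simp
  from int_eval_zeta_power_eq_0[OF p nv this] have "int_eval f (zeta p ^ (w * v)) = 0"
    by (simp add: mult.commute flip: power_mult)
  also have "zeta p ^ (w * v) = zeta p ^ 1"
    using v zeta_power_eq_iff p by (metis prime_gt_0_nat)
  finally show "int_eval f (zeta p) = 0" by simp
qed (rule int_eval_zeta_power_eq_0[OF p w])

section \<open>The cyclotomic field and its automorphisms\<close>

lemma type_ring_simps [simp]:
  "carrier (ring_of_type_algebra :: 'a::field ring) = UNIV"
  "x \<otimes>\<^bsub>ring_of_type_algebra\<^esub> y = x * (y::'a)"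
  "x \<oplus>\<^bsub>ring_of_type_algebra\<^esub> y = x + (y::'a)"
  "\<one>\<^bsub>ring_of_type_algebra\<^esub> = (1::'a)"
  "\<zero>\<^bsub>ring_of_type_algebra\<^esub> = (0::'a)"
  by (simp_all add: ring_of_type_algebra_def)

lemma type_ring_uminus [simp]: "\<ominus>\<^bsub>ring_of_type_algebra\<^esub> (x::'a::field) = - x"
proof -
  interpret R: ring "ring_of_type_algebra :: 'a ring" by (rule ring_from_type_algebra)
  show ?thesis by (rule R.minus_equality) simp_all
qed

lemma type_ring_inverse [simp]:
  assumes "x \<noteq> 0"
  shows "inv\<^bsub>ring_of_type_algebra\<^esub> (x::'a::field) = inverse x"
proof -
  interpret R: ring "ring_of_type_algebra :: 'a ring" by (rule ring_from_type_algebra)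
  show ?thesis by (rule R.inv_char) (use assms in simp_all)
qed

lemma cyclotomic_field_closed:
  shows "1 \<in> cyclotomic_field p" "0 \<in> cyclotomic_field p" "zeta p \<in> cyclotomic_field p"
    and "x \<in> cyclotomic_field p \<Longrightarrow> - x \<in> cyclotomic_field p"
    and "x \<in> cyclotomic_field p \<Longrightarrow> inverse x \<in> cyclotomic_field p"
    and "x \<in> cyclotomic_field p \<Longrightarrow> y \<in> cyclotomic_field p \<Longrightarrow> x + y \<in> cyclotomic_field p"
    and "x \<in> cyclotomic_field p \<Longrightarrow> y \<in> cyclotomic_field p \<Longrightarrow> x * y \<in> cyclotomic_field p"
proof -
  let ?R = "ring_of_type_algebra :: complex ring"
  note gf = generate_field.intros[where R = ?R and H = "{zeta p}", folded cyclotomic_field_def]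
  show one: "1 \<in> cyclotomic_field p" using gf(1) by simp
  show um: "- x \<in> cyclotomic_field p" if "x \<in> cyclotomic_field p" for x using gf(3)[OF that] by simp
  show add: "x + y \<in> cyclotomic_field p" if "x \<in> cyclotomic_field p" "y \<in> cyclotomic_field p" for x y
    using gf(5)[OF that] by simp
  show zero: "0 \<in> cyclotomic_field p" using add[OF one um[OF one]] by simp
  show "zeta p \<in> cyclotomic_field p" using gf(2) by simp
  show "inverse x \<in> cyclotomic_field p" if "x \<in> cyclotomic_field p" for x
    using gf(4)[OF that] zero by (cases "x = 0") simp_all
  show "x * y \<in> cyclotomic_field p" if "x \<in> cyclotomic_field p" "y \<in> cyclotomic_field p" for x y
    using gf(6)[OF that] by simp
qed

lemma int_eval_in_cyclotomic_field:
  assumes "x \<in> cyclotomic_field p"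
  shows "int_eval f x \<in> cyclotomic_field p"
proof -
  have "of_int c \<in> cyclotomic_field p" for c
    by (induction c rule: int_induct[where k = 0])
      (auto intro: cyclotomic_field_closed simp: diff_conv_add_uminus simp del: add_uminus_conv_diff)
  then show ?thesis by (induction f) (auto intro: cyclotomic_field_closed assms)
qed

text \<open>
  Quotients of integer polynomials at \<open>\<zeta>\<close> form a field by the usual rules for fractions, so no
  inverses in \<open>\<rat>[\<zeta>]\<close> have to be constructed.
\<close>

lemma cyclotomic_field_iff:
  "x \<in> cyclotomic_field p \<longleftrightarrow>
     (\<exists>f g. int_eval g (zeta p) \<noteq> 0 \<and> x = int_eval f (zeta p) / int_eval g (zeta p))"
proof
  assume "x \<in> cyclotomic_field p"
  then show "\<exists>f g. int_eval g (zeta p) \<noteq> 0 \<and> x = int_eval f (zeta p) / int_eval g (zeta p)"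
    unfolding cyclotomic_field_def
  proof (induction rule: generate_field.induct)
    case one
    show ?case by (rule exI[of _ 1], rule exI[of _ 1]) simp
  next
    case (incl h)
    then show ?case by (intro exI[of _ "monom 1 1"] exI[of _ 1]) simp
  next
    case (a_inv h)
    then obtain f g where "int_eval g (zeta p) \<noteq> 0" "h = int_eval f (zeta p) / int_eval g (zeta p)" by blast
    then show ?case by (intro exI[of _ "- f"] exI[of _ g]) simp
  next
    case (m_inv h)
    then obtain f g where "int_eval g (zeta p) \<noteq> 0" "h = int_eval f (zeta p) / int_eval g (zeta p)" by blast
    with m_inv.hyps show ?case by (intro exI[of _ g] exI[of _ f]) auto
  next
    case (eng_add x y)
    then obtain f g f' g' where "int_eval g (zeta p) \<noteq> 0" "x = int_eval f (zeta p) / int_eval g (zeta p)"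
      "int_eval g' (zeta p) \<noteq> 0" "y = int_eval f' (zeta p) / int_eval g' (zeta p)" by blast
    then show ?case
      by - (rule exI[of _ "f * g' + f' * g"], rule exI[of _ "g * g'"], simp add: add_frac_eq)
  next
    case (eng_mult x y)
    then obtain f g f' g' where "int_eval g (zeta p) \<noteq> 0" "x = int_eval f (zeta p) / int_eval g (zeta p)"
      "int_eval g' (zeta p) \<noteq> 0" "y = int_eval f' (zeta p) / int_eval g' (zeta p)" by blast
    then show ?case by (intro exI[of _ "f * f'"] exI[of _ "g * g'"]) simp
  qed
next
  assume "\<exists>f g. int_eval g (zeta p) \<noteq> 0 \<and> x = int_eval f (zeta p) / int_eval g (zeta p)"
  then show "x \<in> cyclotomic_field p"
    by (auto simp: divide_inverse intro!: cyclotomic_field_closed int_eval_in_cyclotomic_field)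
qed

text \<open>
  The automorphism that replaces \<open>\<zeta>\<close> by \<open>\<zeta>\<^sup>w\<close> in a quotient of integer polynomials at \<open>\<zeta>\<close>. For \<open>w\<close> prime
  to \<open>p\<close> the value is independent of the representation, by the conjugacy of \<open>\<zeta>\<close> and \<open>\<zeta>\<^sup>w\<close>. It is
  extensional because the elements of the Galois group are.
\<close>

definition zeta_conj :: "nat \<Rightarrow> nat \<Rightarrow> complex \<Rightarrow> complex" where
  "zeta_conj p w = (\<lambda>x\<in>cyclotomic_field p. THE y. \<exists>f g. int_eval g (zeta p) \<noteq> 0
     \<and> x = int_eval f (zeta p) / int_eval g (zeta p)
     \<and> y = int_eval f (zeta p ^ w) / int_eval g (zeta p ^ w))"

lemma zeta_conj_quotient:
  assumes p: "prime p" and w: "\<not> p dvd w" and g: "int_eval g (zeta p) \<noteq> 0"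
  shows "zeta_conj p w (int_eval f (zeta p) / int_eval g (zeta p)) =
           int_eval f (zeta p ^ w) / int_eval g (zeta p ^ w)"
proof -
  let ?x = "int_eval f (zeta p) / int_eval g (zeta p)"
  let ?y = "int_eval f (zeta p ^ w) / int_eval g (zeta p ^ w)"
  have "?x \<in> cyclotomic_field p" using g by (auto simp: cyclotomic_field_iff)
  moreover have "(THE y. \<exists>f g. int_eval g (zeta p) \<noteq> 0
     \<and> ?x = int_eval f (zeta p) / int_eval g (zeta p)
     \<and> y = int_eval f (zeta p ^ w) / int_eval g (zeta p ^ w)) = ?y"
  proof (rule the_equality)
    fix y assume "\<exists>f g. int_eval g (zeta p) \<noteq> 0
     \<and> ?x = int_eval f (zeta p) / int_eval g (zeta p)
     \<and> y = int_eval f (zeta p ^ w) / int_eval g (zeta p ^ w)"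
    then obtain f' g' where g': "int_eval g' (zeta p) \<noteq> 0"
      and x: "?x = int_eval f' (zeta p) / int_eval g' (zeta p)"
      and y: "y = int_eval f' (zeta p ^ w) / int_eval g' (zeta p ^ w)" by blast
    \<comment> \<open>Equality of two fractions is a polynomial relation at \<open>\<zeta>\<close>, and so holds at \<open>\<zeta>\<^sup>w\<close> too.\<close>
    have "int_eval (f * g' - f' * g) (zeta p) = 0" using x g g' by (simp add: field_simps)
    then have "int_eval (f * g' - f' * g) (zeta p ^ w) = 0"
      using int_eval_zeta_power_eq_0_iff[OF p w] by blast
    moreover have "int_eval g (zeta p ^ w) \<noteq> 0" "int_eval g' (zeta p ^ w) \<noteq> 0"
      using int_eval_zeta_power_eq_0_iff[OF p w] g g' by auto
    ultimately show "y = ?y" unfolding y by (simp add: field_simps)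
  qed (use g in blast)
  ultimately show ?thesis by (simp add: zeta_conj_def)
qed

lemma zeta_conj_int_eval:
  assumes "prime p" "\<not> p dvd w"
  shows "zeta_conj p w (int_eval f (zeta p)) = int_eval f (zeta p ^ w)"
  using zeta_conj_quotient[OF assms, of 1 f] by simp

lemma zeta_conj_zeta:
  assumes "prime p" "\<not> p dvd w"
  shows "zeta_conj p w (zeta p) = zeta p ^ w"
  using zeta_conj_int_eval[OF assms, of "monom 1 1"] by simp

lemma zeta_conj_cong:
  assumes "p > 0" "[v = w] (mod p)"
  shows "zeta_conj p v = zeta_conj p w"
  using assms by (simp add: zeta_conj_def zeta_power_eq_iff[THEN iffD2])

lemma zeta_conj_eq_iff:
  assumes "prime p" "\<not> p dvd v" "\<not> p dvd w"
  shows "zeta_conj p v = zeta_conj p w \<longleftrightarrow> [v = w] (mod p)"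
  using zeta_conj_zeta[OF assms(1,2)] zeta_conj_zeta[OF assms(1,3)]
    zeta_power_eq_iff[of p v w] zeta_conj_cong[of p v w] prime_gt_0_nat[OF assms(1)] by metis

lemma zeta_conj_extensional: "zeta_conj p w \<in> extensional (cyclotomic_field p)"
  by (simp add: zeta_conj_def)

lemma zeta_conj_1:
  assumes "prime p" "x \<in> cyclotomic_field p"
  shows "zeta_conj p 1 x = x"
proof -
  obtain f g where "int_eval g (zeta p) \<noteq> 0" "x = int_eval f (zeta p) / int_eval g (zeta p)"
    using assms(2) by (auto simp: cyclotomic_field_iff)
  moreover have "\<not> p dvd 1" using assms(1) by auto
  ultimately show ?thesis using zeta_conj_quotient[OF assms(1), of 1 g f] by simp
qed

context
  fixes p w :: nat
  assumes p: "prime p" and w: "\<not> p dvd w"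
begin

lemma zeta_conj_in_field:
  assumes "x \<in> cyclotomic_field p"
  shows "zeta_conj p w x \<in> cyclotomic_field p"
proof -
  obtain f g where g: "int_eval g (zeta p) \<noteq> 0" and x: "x = int_eval f (zeta p) / int_eval g (zeta p)"
    using assms by (auto simp: cyclotomic_field_iff)
  have "int_eval h (zeta p ^ w) \<in> cyclotomic_field p" for h
    using int_eval_in_cyclotomic_field[OF cyclotomic_field_closed(3), of "h \<circ>\<^sub>p monom 1 w"] by simp
  then show ?thesis
    unfolding x zeta_conj_quotient[OF p w g] by (auto simp: divide_inverse intro!: cyclotomic_field_closed)
qed

lemma zeta_conj_add_mult:
  assumes "x \<in> cyclotomic_field p" "y \<in> cyclotomic_field p"
  shows "zeta_conj p w (x + y) = zeta_conj p w x + zeta_conj p w y" (is ?add)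
    and "zeta_conj p w (x * y) = zeta_conj p w x * zeta_conj p w y" (is ?mult)
proof -
  obtain f g where g: "int_eval g (zeta p) \<noteq> 0" and x: "x = int_eval f (zeta p) / int_eval g (zeta p)"
    using assms by (auto simp: cyclotomic_field_iff)
  obtain f' g' where g': "int_eval g' (zeta p) \<noteq> 0" and y: "y = int_eval f' (zeta p) / int_eval g' (zeta p)"
    using assms by (auto simp: cyclotomic_field_iff)
  have gg: "int_eval (g * g') (zeta p) \<noteq> 0" using g g' by simp
  have gw: "int_eval g (zeta p ^ w) \<noteq> 0" "int_eval g' (zeta p ^ w) \<noteq> 0"
    using int_eval_zeta_power_eq_0_iff[OF p w] g g' by auto
  have "x + y = int_eval (f * g' + f' * g) (zeta p) / int_eval (g * g') (zeta p)"
    using g g' by (simp add: x y add_frac_eq)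
  then show ?add
    using gw unfolding x y zeta_conj_quotient[OF p w g] zeta_conj_quotient[OF p w g']
    by (simp only: zeta_conj_quotient[OF p w gg]) (simp add: add_frac_eq)
  have "x * y = int_eval (f * f') (zeta p) / int_eval (g * g') (zeta p)"
    by (simp add: x y)
  then show ?mult
    unfolding x y zeta_conj_quotient[OF p w g] zeta_conj_quotient[OF p w g']
    by (simp only: zeta_conj_quotient[OF p w gg]) simp
qed

lemma zeta_conj_comp:
  assumes v: "\<not> p dvd v" and "x \<in> cyclotomic_field p"
  shows "zeta_conj p v (zeta_conj p w x) = zeta_conj p (v * w) x"
proof -
  obtain f g where g: "int_eval g (zeta p) \<noteq> 0" and x: "x = int_eval f (zeta p) / int_eval g (zeta p)"
    using assms by (auto simp: cyclotomic_field_iff)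
  have vw: "\<not> p dvd v * w" using p v w by (simp add: prime_dvd_mult_iff)
  have g': "int_eval (g \<circ>\<^sub>p monom 1 w) (zeta p) \<noteq> 0"
    using int_eval_zeta_power_eq_0_iff[OF p w] g by simp
  have "zeta_conj p w x = int_eval (f \<circ>\<^sub>p monom 1 w) (zeta p) / int_eval (g \<circ>\<^sub>p monom 1 w) (zeta p)"
    by (simp add: x zeta_conj_quotient[OF p w g])
  then show ?thesis
    by (simp only: zeta_conj_quotient[OF p v g'] x zeta_conj_quotient[OF p vw g])
      (simp flip: power_mult)
qed

lemma zeta_conj_rat:
  assumes "x \<in> \<rat>"
  shows "zeta_conj p w x = x"
proof -
  obtain a b where b: "b \<noteq> 0" and x: "x = of_int a / of_int b"
    using assms by (metis Rats_cases' of_int_0 less_irrefl)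
  have "int_eval [:b:] (zeta p) \<noteq> 0" using b by simp
  from zeta_conj_quotient[OF p w this, of "[:a:]"] show ?thesis by (simp add: x)
qed

end

lemma zeta_conj_inverse:
  assumes p: "prime p" and "[v * w = 1] (mod p)" and x: "x \<in> cyclotomic_field p"
  shows "zeta_conj p v (zeta_conj p w x) = x"
proof -
  have "\<not> p dvd v * w" using assms(2) p by (metis cong_dvd_iff not_prime_unit)
  then have "\<not> p dvd v" "\<not> p dvd w" by (auto intro: dvd_mult dvd_mult2)
  then have "zeta_conj p v (zeta_conj p w x) = zeta_conj p (v * w) x"
    using zeta_conj_comp p x by simp
  also have "\<dots> = zeta_conj p 1 x"
    using zeta_conj_cong[OF prime_gt_0_nat[OF p] assms(2)] by simp
  finally show ?thesis using zeta_conj_1[OF p x] by simp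
qed

lemma zeta_conj_Bij:
  assumes p: "prime p" and w: "\<not> p dvd w"
  shows "zeta_conj p w \<in> Bij (cyclotomic_field p)"
proof -
  obtain v where v: "\<not> p dvd v" "[w * v = 1] (mod p)" using inverse_mod_prime[OF p w] .
  have "bij_betw (zeta_conj p w) (cyclotomic_field p) (cyclotomic_field p)"
    using v w p by (intro bij_betwI[where g = "zeta_conj p v"])
      (simp_all add: zeta_conj_in_field zeta_conj_inverse mult.commute)
  then show ?thesis by (simp add: Bij_def zeta_conj_extensional)
qed

section \<open>The Galois group and its subgroups\<close>

lemma galois_group_simps:
  shows "\<sigma> \<in> carrier (galois_group p) \<longleftrightarrow>
      \<sigma> \<in> Bij (cyclotomic_field p) \<and> \<sigma> 1 = 1 \<and> (\<forall>x\<in>\<rat>. \<sigma> x = x) \<and>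
      (\<forall>x\<in>cyclotomic_field p. \<forall>y\<in>cyclotomic_field p.
         \<sigma> (x + y) = \<sigma> x + \<sigma> y \<and> \<sigma> (x * y) = \<sigma> x * \<sigma> y)"
    and "\<one>\<^bsub>galois_group p\<^esub> = (\<lambda>x\<in>cyclotomic_field p. x)"
    and "\<sigma> \<in> carrier (galois_group p) \<Longrightarrow> \<tau> \<in> carrier (galois_group p) \<Longrightarrow>
      \<sigma> \<otimes>\<^bsub>galois_group p\<^esub> \<tau> = compose (cyclotomic_field p) \<sigma> \<tau>"
  using Bij_imp_funcset[of \<sigma> "cyclotomic_field p"]
  by (auto simp: galois_group_def Let_def BijGroup_def ring_hom_def)

text \<open>
  An automorphism maps \<open>\<zeta>\<close> to a \<open>p\<close>-th root of unity different from \<open>1\<close>, and its value at \<open>\<zeta>\<close>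
  determines it on all quotients of integer polynomials at \<open>\<zeta>\<close>.
\<close>

lemma galois_group_imp_zeta_conj:
  assumes p: "prime p" and \<sigma>: "\<sigma> \<in> carrier (galois_group p)"
  obtains w where "\<not> p dvd w" "\<sigma> = zeta_conj p w"
proof -
  let ?K = "cyclotomic_field p"
  note K = cyclotomic_field_closed
  have p0: "p > 0" using p by (rule prime_gt_0_nat)
  have bij: "\<sigma> \<in> Bij ?K" and one: "\<sigma> 1 = 1" and rat: "\<And>x. x \<in> \<rat> \<Longrightarrow> \<sigma> x = x"
    and add: "\<And>x y. x \<in> ?K \<Longrightarrow> y \<in> ?K \<Longrightarrow> \<sigma> (x + y) = \<sigma> x + \<sigma> y"
    and mult: "\<And>x y. x \<in> ?K \<Longrightarrow> y \<in> ?K \<Longrightarrow> \<sigma> (x * y) = \<sigma> x * \<sigma> y"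
    using \<sigma> by (auto simp: galois_group_simps(1))
  have inj: "inj_on \<sigma> ?K" using bij by (simp add: Bij_def bij_betw_def)
  have eval: "\<sigma> (int_eval f (zeta p)) = int_eval f (\<sigma> (zeta p))" for f
  proof (induction f)
    case 0
    then show ?case using rat[of 0] by simp
  next
    case (pCons c f)
    have "of_int c \<in> ?K" using int_eval_in_cyclotomic_field[OF K(3), of "[:c:]" p] by simp
    then show ?case
      using pCons K(3) int_eval_in_cyclotomic_field[OF K(3)] by (simp add: add mult rat K(7))
  qed
  have "\<sigma> (zeta p) ^ p = \<sigma> (zeta p ^ p)" using eval[of "monom 1 p"] by (simp add: zeta_power_p)
  also have "\<dots> = 1" by (simp add: one)
  finally obtain w where w: "\<sigma> (zeta p) = zeta p ^ w"
    using root_of_unity_is_zeta_power[OF p0] by blast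
  have nw: "\<not> p dvd w"
  proof
    assume "p dvd w"
    then have "\<sigma> (zeta p) = \<sigma> 1" using w one zeta_power_eq_1_iff[OF p0] by simp
    then have "zeta p = 1" using inj K by (meson inj_onD)
    then show False using zeta_power_eq_1_iff[OF p0, of 1] p by auto
  qed
  have "\<sigma> x = zeta_conj p w x" if xK: "x \<in> ?K" for x
  proof -
    obtain f g where g: "int_eval g (zeta p) \<noteq> 0" and x: "x = int_eval f (zeta p) / int_eval g (zeta p)"
      using xK unfolding cyclotomic_field_iff by blast
    have "\<sigma> x * \<sigma> (int_eval g (zeta p)) = \<sigma> (int_eval f (zeta p))"
      using mult[OF xK int_eval_in_cyclotomic_field[OF K(3), of g]] g by (simp add: x)
    moreover have "int_eval g (zeta p ^ w) \<noteq> 0" using g int_eval_zeta_power_eq_0_iff[OF p nw] by simp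
    ultimately show ?thesis
      unfolding x zeta_conj_quotient[OF p nw g] by (simp add: eval w nonzero_eq_divide_eq)
  qed
  then have "\<sigma> = zeta_conj p w"
    using bij by (intro extensionalityI[of _ ?K]) (auto simp: Bij_def zeta_conj_extensional)
  with nw show ?thesis by (rule that)
qed

lemma zeta_conj_in_galois_group:
  assumes "prime p" "\<not> p dvd w"
  shows "zeta_conj p w \<in> carrier (galois_group p)"
  using assms by (simp add: galois_group_simps(1) zeta_conj_Bij zeta_conj_rat zeta_conj_add_mult)

lemma carrier_galois_group:
  assumes "prime p"
  shows "carrier (galois_group p) = zeta_conj p ` {w. \<not> p dvd w}"
  using galois_group_imp_zeta_conj[OF assms] zeta_conj_in_galois_group[OF assms] by blast

lemma galois_group_mult:
  assumes "prime p" "\<not> p dvd v" "\<not> p dvd w"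
  shows "zeta_conj p v \<otimes>\<^bsub>galois_group p\<^esub> zeta_conj p w = zeta_conj p (v * w)"
proof -
  have "compose (cyclotomic_field p) (zeta_conj p v) (zeta_conj p w) = zeta_conj p (v * w)"
    using assms by (intro extensionalityI[of _ "cyclotomic_field p"])
      (simp_all add: zeta_conj_extensional compose_eq zeta_conj_comp)
  then show ?thesis using assms by (simp add: galois_group_simps(3) zeta_conj_in_galois_group)
qed

lemma galois_group_one:
  assumes "prime p"
  shows "\<one>\<^bsub>galois_group p\<^esub> = zeta_conj p 1"
  unfolding galois_group_simps(2)
  by (rule extensionalityI[of _ "cyclotomic_field p"])
    (simp_all add: zeta_conj_extensional zeta_conj_1[OF assms, simplified])

lemma group_galois_group:
  assumes p: "prime p"
  shows "group (galois_group p)"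
proof (rule groupI)
  have p1: "\<not> p dvd 1" using p by auto
  note simps = carrier_galois_group[OF p] galois_group_mult[OF p] galois_group_one[OF p]
    prime_dvd_mult_iff[OF p]
  show "\<one>\<^bsub>galois_group p\<^esub> \<in> carrier (galois_group p)" using p1 by (auto simp: simps)
  show "x \<otimes>\<^bsub>galois_group p\<^esub> y \<in> carrier (galois_group p)"
    if "x \<in> carrier (galois_group p)" "y \<in> carrier (galois_group p)" for x y
    using that by (auto simp: simps)
  show "x \<otimes>\<^bsub>galois_group p\<^esub> y \<otimes>\<^bsub>galois_group p\<^esub> z =
      x \<otimes>\<^bsub>galois_group p\<^esub> (y \<otimes>\<^bsub>galois_group p\<^esub> z)"
    if "x \<in> carrier (galois_group p)" "y \<in> carrier (galois_group p)" "z \<in> carrier (galois_group p)"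
    for x y z
    using that by (auto simp: simps mult.assoc)
  show "\<one>\<^bsub>galois_group p\<^esub> \<otimes>\<^bsub>galois_group p\<^esub> x = x" if "x \<in> carrier (galois_group p)" for x
    using that galois_group_mult[OF p p1] by (auto simp: carrier_galois_group[OF p] galois_group_one[OF p])
  show "\<exists>y\<in>carrier (galois_group p). y \<otimes>\<^bsub>galois_group p\<^esub> x = \<one>\<^bsub>galois_group p\<^esub>"
    if x: "x \<in> carrier (galois_group p)" for x
  proof -
    obtain w where w: "\<not> p dvd w" "x = zeta_conj p w"
      using x unfolding carrier_galois_group[OF p] by blast
    obtain v where v: "\<not> p dvd v" "[w * v = 1] (mod p)" using inverse_mod_prime[OF p w(1)] .
    then have "zeta_conj p v \<otimes>\<^bsub>galois_group p\<^esub> x = \<one>\<^bsub>galois_group p\<^esub>"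
      using w zeta_conj_cong[OF prime_gt_0_nat[OF p] v(2)] by (simp add: simps mult.commute)
    then show ?thesis using zeta_conj_in_galois_group[OF p v(1)] by blast
  qed
qed

lemma galois_group_pow:
  assumes p: "prime p" and w: "\<not> p dvd w"
  shows "zeta_conj p w [^]\<^bsub>galois_group p\<^esub> (k::nat) = zeta_conj p (w ^ k)"
proof (induction k)
  case 0
  then show ?case using galois_group_one[OF p] by simp
next
  case (Suc k)
  have "\<not> p dvd w ^ k" using p w by (metis prime_dvd_power)
  with Suc show ?case using galois_group_mult[OF p] w by (simp add: mult.commute)
qed

text \<open>
  For a primitive root \<open>g\<close>, the solutions of \<open>w\<^sup>m = 1\<close> are the powers of \<open>g\<close> whose exponent is a
  multiple of \<open>(p - 1) / m\<close>.
\<close>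

lemma card_roots_of_unity_mod_prime:
  fixes p m :: nat
  assumes p: "prime p" and m: "m dvd p - 1"
  shows "card {w \<in> {1..<p}. [w ^ m = 1] (mod p)} = m"
proof -
  have p1: "p > 1" using p by (rule prime_gt_1_nat)
  obtain g where g: "residue_primroot p g"
    using prime_primitive_root_exists[OF p1 p] by blast
  then have ord: "ord p g = p - 1" using p by (simp add: residue_primroot_def totient_prime)
  have bij: "bij_betw (\<lambda>i. g ^ i mod p) {..<p - 1} {1..<p}"
  proof -
    have "totatives p = {1..<p}" using p by (auto simp: totatives_prime)
    then show ?thesis using residue_primroot_is_generator[OF p1 g] p by (simp add: totient_prime)
  qed
  obtain k where k: "p - 1 = m * k" using m by (auto elim: dvdE)
  then have mk: "m > 0" "k > 0" using p1 by (cases "m = 0"; cases "k = 0"; simp)+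
  have iff: "[(g ^ i mod p) ^ m = 1] (mod p) \<longleftrightarrow> k dvd i" for i
  proof -
    have "[(g ^ i mod p) ^ m = 1] (mod p) \<longleftrightarrow> [g ^ (i * m) = 1] (mod p)"
      by (simp add: cong_def power_mod power_mult)
    also have "\<dots> \<longleftrightarrow> m * k dvd i * m" using ord_divides[of g "i * m" p] ord k by simp
    also have "\<dots> \<longleftrightarrow> k dvd i" using mk by (simp add: mult.commute)
    finally show ?thesis .
  qed
  have img: "{1..<p} = (\<lambda>i. g ^ i mod p) ` {..<p - 1}" using bij by (simp add: bij_betw_def)
  have "{w \<in> {1..<p}. [w ^ m = 1] (mod p)} =
      (\<lambda>i. g ^ i mod p) ` {i \<in> {..<p - 1}. [(g ^ i mod p) ^ m = 1] (mod p)}"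
    unfolding img by blast
  also have "\<dots> = (\<lambda>i. g ^ i mod p) ` {i \<in> {..<p - 1}. k dvd i}" by (simp only: iff)
  also have "card \<dots> = card {i \<in> {..<p - 1}. k dvd i}"
    using bij by (intro card_image inj_on_subset[OF bij_betw_imp_inj_on[OF bij]]) auto
  also have "{i \<in> {..<p - 1}. k dvd i} = (*) k ` {..<m}"
    using mk unfolding k by (auto elim!: dvdE simp: mult.commute)
  also have "card \<dots> = m" using mk by (subst card_image) (auto intro!: inj_onI)
  finally show ?thesis .
qed

text \<open>
  A subgroup of order \<open>m\<close> is contained in the set of automorphisms \<open>\<sigma>\<^sub>w\<close> with \<open>w\<^sup>m = 1\<close> modulo \<open>p\<close>, by
  Lagrange's theorem. This set is itself a subgroup and has \<open>m\<close> elements, so it is the only one; this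
  makes the definite description in \<^const>\<open>cyclotomic_subfield\<close> denote it.
\<close>

lemma cyclotomic_subfield_iff:
  assumes p: "prime p" and m: "m dvd p - 1"
  shows "x \<in> cyclotomic_subfield p m \<longleftrightarrow>
    x \<in> cyclotomic_field p \<and> (\<forall>w. [w ^ m = 1] (mod p) \<longrightarrow> zeta_conj p w x = x)"
proof -
  let ?G = "galois_group p"
  define U where "U = {w \<in> {1..<p}. [w ^ m = 1] (mod p)}"
  interpret G: group ?G using p by (rule group_galois_group)
  have p0: "p > 0" and p1: "p > 1" using p prime_gt_0_nat prime_gt_1_nat by auto
  have m0: "m > 0" using m p1 by (auto intro: Nat.gr0I)
  have ndvd: "\<not> p dvd w" if "[w ^ m = 1] (mod p)" for w
    using that p m0 by (metis cong_dvd_iff dvd_power dvd_trans not_prime_unit)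
  have U_img: "zeta_conj p w \<in> zeta_conj p ` U" if "[w ^ m = 1] (mod p)" for w
  proof -
    have "w mod p \<noteq> 0" using ndvd[OF that] by (simp add: mod_eq_0_iff_dvd)
    then have "w mod p \<in> U" using that p0 by (simp add: U_def cong_def power_mod)
    moreover have "zeta_conj p w = zeta_conj p (w mod p)" using p0 by (intro zeta_conj_cong) (simp_all add: cong_def)
    ultimately show ?thesis by blast
  qed
  have U: "[w ^ m = 1] (mod p)" "\<not> p dvd w" if "w \<in> U" for w
    using that ndvd by (auto simp: U_def)
  have cardU: "card (zeta_conj p ` U) = m"
  proof -
    have "inj_on (zeta_conj p) U"
    proof (rule inj_onI)
      fix v w assume vw: "v \<in> U" "w \<in> U" "zeta_conj p v = zeta_conj p w"
      then have "[v = w] (mod p)" using zeta_conj_eq_iff[OF p] U(2) by blast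
      with vw(1,2) show "v = w" by (simp add: U_def cong_less_modulus_unique_nat)
    qed
    then show ?thesis using card_roots_of_unity_mod_prime[OF p m] by (simp add: card_image U_def)
  qed
  have sub: "subgroup (zeta_conj p ` U) ?G"
  proof (rule G.subgroupI)
    show "zeta_conj p ` U \<subseteq> carrier ?G" using U(2) zeta_conj_in_galois_group[OF p] by blast
    show "zeta_conj p ` U \<noteq> {}" using cardU m0 by auto
    fix \<sigma> assume "\<sigma> \<in> zeta_conj p ` U"
    then obtain v where v: "v \<in> U" "\<sigma> = zeta_conj p v" by blast
    have "\<not> p dvd v ^ (m - 1)" using U(2)[OF v(1)] p by (metis prime_dvd_power)
    moreover have "[v ^ (m - 1) * v = 1] (mod p)"
      using U(1)[OF v(1)] m0 by (metis power_minus_mult)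
    ultimately have "zeta_conj p (v ^ (m - 1)) \<otimes>\<^bsub>?G\<^esub> \<sigma> = \<one>\<^bsub>?G\<^esub>"
      using v U(2) zeta_conj_cong[OF p0] by (metis galois_group_mult galois_group_one p)
    then have "inv\<^bsub>?G\<^esub> \<sigma> = zeta_conj p (v ^ (m - 1))"
      using v U(2)[OF v(1)] \<open>\<not> p dvd v ^ (m - 1)\<close> zeta_conj_in_galois_group[OF p] by (intro G.inv_equality) auto
    moreover have "[(v ^ (m - 1)) ^ m = 1] (mod p)"
      using cong_pow[OF U(1)[OF v(1)], of "m - 1"] by (metis power_mult mult.commute power_one)
    ultimately show "inv\<^bsub>?G\<^esub> \<sigma> \<in> zeta_conj p ` U" using U_img by simp
    fix \<tau> assume "\<tau> \<in> zeta_conj p ` U"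
    then obtain w where w: "w \<in> U" "\<tau> = zeta_conj p w" by blast
    have "[(v * w) ^ m = 1] (mod p)"
      using cong_mult[OF U(1)[OF v(1)] U(1)[OF w(1)]] by (simp add: power_mult_distrib)
    then show "\<sigma> \<otimes>\<^bsub>?G\<^esub> \<tau> \<in> zeta_conj p ` U"
      using U_img U(2) v w galois_group_mult[OF p] by simp
  qed
  have uniq: "H = zeta_conj p ` U" if H: "subgroup H ?G" "card H = m" for H
  proof (rule card_subset_eq)
    show "finite (zeta_conj p ` U)" by (simp add: U_def)
    show "card H = card (zeta_conj p ` U)" using H(2) cardU by simp
    show "H \<subseteq> zeta_conj p ` U"
    proof
      fix \<sigma> assume \<sigma>: "\<sigma> \<in> H"
      then have "\<sigma> \<in> carrier ?G" using H(1) subgroup.subset by blast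
      then obtain w where w: "\<not> p dvd w" "\<sigma> = zeta_conj p w" using galois_group_imp_zeta_conj[OF p] by blast
      interpret H: group "?G\<lparr>carrier := H\<rparr>" using H(1) by (rule G.subgroup_imp_group)
      have "\<sigma> [^]\<^bsub>?G\<^esub> m = \<one>\<^bsub>?G\<^esub>"
        using H.pow_order_eq_1[of \<sigma>] \<sigma> H(2) by (simp add: Coset.order_def flip: G.nat_pow_consistent)
      then have "zeta_conj p (w ^ m) = zeta_conj p 1"
        using w galois_group_pow[OF p] galois_group_one[OF p] by simp
      moreover have "\<not> p dvd w ^ m" using w(1) p by (metis prime_dvd_power)
      moreover have "\<not> p dvd 1" using p by auto
      ultimately have "[w ^ m = 1] (mod p)" using zeta_conj_eq_iff[OF p] by blast
      then show "\<sigma> \<in> zeta_conj p ` U" using U_img w by simp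
    qed
  qed
  have "(THE H. subgroup H ?G \<and> card H = m) = zeta_conj p ` U"
    by (rule the_equality) (use sub cardU uniq in blast)+
  moreover have "(\<forall>\<sigma>\<in>zeta_conj p ` U. \<sigma> x = x) \<longleftrightarrow>
      (\<forall>w. [w ^ m = 1] (mod p) \<longrightarrow> zeta_conj p w x = x)"
    using U(1) U_img by blast
  ultimately show ?thesis by (simp add: cyclotomic_subfield_def)
qed

text \<open>
  Kloosterman sums are sums of powers of \<open>\<zeta>\<close>, which is all that the Galois action needs to know about
  them.
\<close>

lemma zeta_conj_sum_zeta_powers:
  fixes k :: "'b \<Rightarrow> nat"
  assumes "prime p" "\<not> p dvd w"
  shows "zeta_conj p w (\<Sum>x\<in>A. zeta p ^ k x) = (\<Sum>x\<in>A. (zeta p ^ k x) ^ w)"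
  using zeta_conj_int_eval[OF assms, of "\<Sum>x\<in>A. monom 1 (k x)"]
  by (simp add: mult.commute flip: power_mult)

lemma sum_zeta_powers_in_cyclotomic_field:
  "(\<Sum>x\<in>A. zeta p ^ k x) \<in> cyclotomic_field p"
  using int_eval_in_cyclotomic_field[OF cyclotomic_field_closed(3), of "\<Sum>x\<in>A. monom 1 (k x)" p] by simp

section \<open>Trace and additive character of a finite field\<close>

lemma power_cong_exponent:
  fixes x :: "'a::monoid_mult"
  assumes "x ^ e = 1" "[i = j] (mod e)"
  shows "x ^ i = x ^ j"
proof -
  have "x ^ k = x ^ (k mod e)" for k
  proof -
    have "x ^ k = x ^ (e * (k div e) + k mod e)" by simp
    also have "\<dots> = x ^ (k mod e)" by (simp only: power_add power_mult assms(1) power_one mult_1_left)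
    finally show ?thesis .
  qed
  then show ?thesis using assms(2) by (metis cong_def)
qed

lemma CHAR_eq:
  assumes "prime p" "CARD('a::finite_field) = p ^ r"
  shows "CHAR('a) = p"
proof -
  have "CHAR('a) dvd p ^ r" using CHAR_dvd_CARD[where 'a = 'a] assms(2) by simp
  then have "CHAR('a) dvd p" by (rule prime_dvd_power[OF CHAR_prime])
  then show ?thesis using assms(1) CHAR_prime[where 'a = 'a] by (simp add: primes_dvd_imp_eq)
qed

lemma of_nat_power_CHAR: "(of_nat k :: 'a::finite_field) ^ CHAR('a) = of_nat k"
proof (induction k)
  case (Suc k)
  then show ?case by (simp add: freshmans_dream)
qed (simp add: CHAR_pos)

text \<open>
  The polynomial \<open>X\<^sup>p - X\<close> has at most \<open>p\<close> roots, and the elements of the prime field already are \<open>p\<close>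
  roots. Applied to traces, this justifies the definite description in \<^const>\<open>add_char\<close>.
\<close>

lemma power_CHAR_fixed_imp_of_nat:
  fixes y :: "'a::finite_field"
  assumes "y ^ CHAR('a) = y"
  shows "\<exists>!k. k < CHAR('a) \<and> of_nat k = y"
proof -
  let ?p = "CHAR('a)"
  let ?P = "monom 1 ?p - monom 1 1 :: 'a poly"
  have p1: "?p > 1" using CHAR_prime by (rule prime_gt_1_nat)
  have "coeff ?P ?p = 1" using p1 by simp
  then have nz: "?P \<noteq> 0" by (metis coeff_0 zero_neq_one)
  have deg: "degree ?P \<le> ?p"
    using p1 by (intro degree_diff_le order.trans[OF degree_monom_le]) auto
  have inj: "inj_on (of_nat :: nat \<Rightarrow> 'a) {..<?p}"
    by (rule inj_onI) (auto simp: of_nat_eq_iff_cong_CHAR cong_less_modulus_unique_nat)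
  have roots: "of_nat ` {..<?p} = {y::'a. y ^ ?p = y}"
  proof (rule card_seteq)
    show "of_nat ` {..<?p} \<subseteq> {y::'a. y ^ ?p = y}" by (auto simp: of_nat_power_CHAR)
    have "{y::'a. y ^ ?p = y} = {y. poly ?P y = 0}" by (auto simp: poly_monom)
    then have "card {y::'a. y ^ ?p = y} \<le> degree ?P" using card_poly_roots_bound[OF nz] by simp
    also have "\<dots> \<le> card ((of_nat :: nat \<Rightarrow> 'a) ` {..<?p})" using deg by (simp add: card_image[OF inj])
    finally show "card {y::'a. y ^ ?p = y} \<le> card ((of_nat :: nat \<Rightarrow> 'a) ` {..<?p})" .
  qed simp
  have "y \<in> of_nat ` {..<?p}" unfolding roots using assms by simp
  then obtain k where "k < ?p" "of_nat k = y" by auto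
  moreover have "j = k" if "j < ?p" "of_nat j = y" for j
    using inj_onD[OF inj, of j k] that \<open>k < ?p\<close> \<open>of_nat k = y\<close> by simp
  ultimately show ?thesis by blast
qed

text \<open>
  Substituting in every coordinate at once; this carries out both changes of variables, by a scaling
  and by Frobenius, in a Kloosterman sum.
\<close>

lemma sum_PiE_reindex:
  fixes h :: "('i \<Rightarrow> 'b) \<Rightarrow> 'c::comm_monoid_add"
  assumes "bij_betw \<phi> A A"
  shows "(\<Sum>x\<in>I \<rightarrow>\<^sub>E A. h (\<lambda>i\<in>I. \<phi> (x i))) = (\<Sum>x\<in>I \<rightarrow>\<^sub>E A. h x)"
proof (rule sum.reindex_bij_witness)
  let ?\<psi> = "the_inv_into A \<phi>"
  have inv: "?\<psi> (\<phi> a) = a" "\<phi> (?\<psi> a) = a" "\<phi> a \<in> A" "?\<psi> a \<in> A" if "a \<in> A" for a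
    using assms that by (auto simp: bij_betw_def the_inv_into_f_f f_the_inv_into_f the_inv_into_into)
  fix x assume x: "x \<in> I \<rightarrow>\<^sub>E A"
  show "(\<lambda>i\<in>I. ?\<psi> ((\<lambda>i\<in>I. \<phi> (x i)) i)) = x" "(\<lambda>i\<in>I. \<phi> ((\<lambda>i\<in>I. ?\<psi> (x i)) i)) = x"
    using x inv by (auto simp: fun_eq_iff PiE_iff extensional_def)
  show "(\<lambda>i\<in>I. \<phi> (x i)) \<in> I \<rightarrow>\<^sub>E A" "(\<lambda>i\<in>I. ?\<psi> (x i)) \<in> I \<rightarrow>\<^sub>E A"
    using x inv by (auto simp: PiE_iff)
qed (rule refl)

context
  fixes p r :: nat
  assumes p: "prime p" and card: "CARD('a::finite_field) = p ^ r"
begin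

lemma power_field_size: "(x::'a) ^ (p ^ r) = x"
  using finite_field_power_card_eq_same[of x] by (simp add: card)

lemma extension_degree_pos: "r > 0"
proof (rule Nat.gr0I)
  assume "r = 0"
  then have "card (UNIV :: 'a set) = 1" using card by simp
  then have "(0::'a) = 1" by (metis UNIV_I card_1_singletonE singletonD)
  then show False by simp
qed

lemma frobenius_sum: "(\<Sum>i\<in>A. f i :: 'a) ^ p = (\<Sum>i\<in>A. f i ^ p)"
  using CHAR_eq[OF p card] p by (intro freshmans_dream_sum) auto

text \<open>
  Frobenius permutes the summands of the trace cyclically, because \<open>x\<^bsup>q\<^esup> = x\<close>.
\<close>

lemma abs_trace_frobenius: "abs_trace p r (x ^ p) = abs_trace p r (x::'a)"
proof -
  have "abs_trace p r (x ^ p) + x = (\<Sum>i<Suc r. x ^ (p ^ i))"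
    unfolding abs_trace_def sum.lessThan_Suc_shift by (simp add: power_mult add.commute)
  also have "\<dots> = abs_trace p r x + x" by (simp add: abs_trace_def power_field_size)
  finally show ?thesis by simp
qed

lemma abs_trace_power_p: "abs_trace p r (x::'a) ^ p = abs_trace p r x"
proof -
  have "abs_trace p r x ^ p = abs_trace p r (x ^ p)"
    by (simp add: abs_trace_def frobenius_sum mult.commute flip: power_mult)
  then show ?thesis by (simp add: abs_trace_frobenius)
qed

text \<open>
  Any representative of the trace, reduced modulo \<open>p\<close> or not, may serve as the exponent of \<open>\<zeta>\<close>.
\<close>

lemma add_char_eqI:
  assumes "of_nat k = abs_trace p r (x::'a)"
  shows "add_char p r x = zeta p ^ k"
proof -
  have "k mod p < p" using p prime_gt_0_nat by simp
  moreover have "(of_nat (k mod p) :: 'a) = abs_trace p r x"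
    using assms by (metis CHAR_eq[OF p card] cong_mod_left cong_refl of_nat_eq_iff_cong_CHAR)
  moreover have "\<exists>!k. k < p \<and> of_nat k = abs_trace p r x"
    using power_CHAR_fixed_imp_of_nat[of "abs_trace p r x"] abs_trace_power_p CHAR_eq[OF p card] by simp
  ultimately have "(THE k. k < p \<and> of_nat k = abs_trace p r x) = k mod p"
    by (intro the1_equality) auto
  then show ?thesis by (simp add: add_char_def zeta_power_mod)
qed

lemma abs_trace_eq_of_nat:
  obtains k where "of_nat k = abs_trace p r (x::'a)"
  using power_CHAR_fixed_imp_of_nat[of "abs_trace p r x"] abs_trace_power_p CHAR_eq[OF p card] by auto

lemma add_char_frobenius: "add_char p r (x ^ p :: 'a) = add_char p r x"
  by (simp add: add_char_def abs_trace_frobenius)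

text \<open>
  The trace is linear over the prime field, whose elements are fixed by Frobenius.
\<close>

lemma add_char_of_nat_mult: "add_char p r (of_nat w * x :: 'a) = add_char p r x ^ w"
proof -
  obtain k where k: "of_nat k = abs_trace p r x" by (rule abs_trace_eq_of_nat)
  have w: "of_nat w ^ (p ^ i) = (of_nat w :: 'a)" for i
    using of_nat_power_CHAR[of w, where 'a = 'a]
    by (induction i) (simp_all add: CHAR_eq[OF p card] power_mult)
  have "abs_trace p r (of_nat w * x) = of_nat w * abs_trace p r x"
    by (simp add: abs_trace_def power_mult_distrib w sum_distrib_left)
  then have "of_nat (k * w) = abs_trace p r (of_nat w * x)" by (simp add: k)
  from add_char_eqI[OF this] show ?thesis by (simp only: add_char_eqI[OF k] power_mult)
qed

section \<open>Symmetries of Kloosterman sums\<close>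

text \<open>
  With \<open>y\<^sub>i = c * x\<^sub>i\<close> one has \<open>c * a / (x\<^sub>1 \<dots> x\<^sub>n) = c\<^bsup>n+1\<^esup> * a / (y\<^sub>1 \<dots> y\<^sub>n)\<close>.
\<close>

lemma zeta_conj_kloosterman:
  assumes w: "\<not> p dvd w"
  shows "zeta_conj p w (kloosterman p r n (a::'a)) = kloosterman p r n (of_nat w ^ (n + 1) * a)"
proof -
  define c where "c = (of_nat w :: 'a)"
  have c: "c \<noteq> 0" using w by (simp add: c_def of_nat_eq_0_iff_char_dvd CHAR_eq[OF p card])
  let ?X = "{1..n} \<rightarrow>\<^sub>E (UNIV - {0::'a})"
  let ?s = "\<lambda>a x. (\<Sum>i=1..n. x i) + a / (\<Prod>i=1..n. x i)"
  have bij: "bij_betw ((*) c) (UNIV - {0}) (UNIV - {0})"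
    by (rule bij_betwI[where g = "\<lambda>x. x / c"]) (use c in auto)
  have "zeta_conj p w (kloosterman p r n a) = (\<Sum>x\<in>?X. add_char p r (?s a x) ^ w)"
    unfolding kloosterman_def add_char_def by (rule zeta_conj_sum_zeta_powers[OF p w])
  also have "\<dots> = (\<Sum>x\<in>?X. add_char p r (c * ?s a x))"
    by (simp only: add_char_of_nat_mult c_def)
  also have "\<dots> = (\<Sum>x\<in>?X. add_char p r (?s (c ^ (n + 1) * a) (\<lambda>i\<in>{1..n}. c * x i)))"
  proof (rule sum.cong[OF refl])
    fix x
    show "add_char p r (c * ?s a x) = add_char p r (?s (c ^ (n + 1) * a) (\<lambda>i\<in>{1..n}. c * x i))"
      using c by (simp add: prod.distrib sum_distrib_left distrib_left mult.assoc)
  qed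
  also have "\<dots> = (\<Sum>x\<in>?X. add_char p r (?s (c ^ (n + 1) * a) x))"
    by (rule sum_PiE_reindex[OF bij])
  finally show ?thesis by (simp only: kloosterman_def c_def)
qed

text \<open>
  Frobenius permutes the nonzero elements and commutes with sums, products and quotients, so it carries
  the terms of one sum to those of the other; the character does not see it.
\<close>

lemma kloosterman_frobenius: "kloosterman p r n (a ^ p :: 'a) = kloosterman p r n a"
proof -
  let ?X = "{1..n} \<rightarrow>\<^sub>E (UNIV - {0::'a})"
  let ?s = "\<lambda>a x. (\<Sum>i=1..n. x i) + a / (\<Prod>i=1..n. x i)"
  have q: "p * p ^ (r - 1) = p ^ r" using extension_degree_pos by (simp flip: power_Suc)
  have bij: "bij_betw (\<lambda>x::'a. x ^ p) (UNIV - {0}) (UNIV - {0})"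
  proof (rule bij_betwI[where g = "\<lambda>x. x ^ (p ^ (r - 1))"])
    show "(x ^ p) ^ (p ^ (r - 1)) = x" for x :: 'a
      using q power_field_size by (metis power_mult)
    show "(x ^ (p ^ (r - 1))) ^ p = x" for x :: 'a
      using q power_field_size by (metis mult.commute power_mult)
  qed auto
  have add: "(x + y) ^ p = x ^ p + y ^ p" for x y :: 'a
    using p CHAR_eq[OF p card] by (intro freshmans_dream) auto
  have "kloosterman p r n (a ^ p) =
      (\<Sum>x\<in>?X. add_char p r (?s (a ^ p) (\<lambda>i\<in>{1..n}. x i ^ p)))"
    unfolding kloosterman_def by (rule sum_PiE_reindex[OF bij, symmetric])
  also have "\<dots> = (\<Sum>x\<in>?X. add_char p r (?s a x ^ p))"
    by (simp add: add frobenius_sum power_divide prod_power_distrib)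
  finally show ?thesis by (simp only: kloosterman_def add_char_frobenius)
qed

lemma kloosterman_frobenius_power: "kloosterman p r n (a ^ (p ^ k) :: 'a) = kloosterman p r n a"
proof (induction k)
  case (Suc k)
  have "a ^ (p ^ Suc k) = (a ^ (p ^ k)) ^ p" by (simp only: power_Suc2 power_mult)
  with Suc show ?case by (simp only: kloosterman_frobenius)
qed simp

end

section \<open>Roots of unity in a finite field\<close>

lemma finite_field_power_card_minus_1:
  fixes x :: "'a::finite_field"
  assumes "x \<noteq> 0"
  shows "x ^ (CARD('a) - 1) = 1"
proof -
  have "x ^ (CARD('a) - 1) * x = x ^ CARD('a)" by (intro power_minus_mult finite_UNIV_card_ge_0 finite)
  also have "\<dots> = x" by (rule finite_field_power_card_eq_same)
  finally show ?thesis using assms by simp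
qed

lemma primitive_element_nonzero:
  assumes "primitive_element \<gamma>"
  shows "\<gamma> \<noteq> 0"
proof -
  have "\<gamma> ^ 1 \<in> range (\<lambda>k::nat. \<gamma> ^ k)" by blast
  then show ?thesis using assms unfolding primitive_element_def by simp
qed

text \<open>
  If \<open>\<gamma>\<^sup>k = 1\<close> with \<open>k\<close> not a multiple of \<open>q - 1\<close>, then \<open>\<gamma>\<close> also has a positive period below \<open>q - 1\<close>,
  and its powers are too few to exhaust the nonzero elements.
\<close>

lemma primitive_element_power_eq_1:
  fixes \<gamma> :: "'a::finite_field"
  assumes \<gamma>: "primitive_element \<gamma>" and k: "\<gamma> ^ k = 1"
  shows "CARD('a) - 1 dvd k"
proof (rule ccontr)
  let ?N = "CARD('a) - 1"
  assume "\<not> ?N dvd k"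
  then have m: "k mod ?N > 0" by (simp add: mod_greater_zero_iff_not_dvd)
  have N0: "?N > 0"
  proof -
    have "card {0, 1 :: 'a} \<le> CARD('a)" by (rule card_mono) auto
    then show ?thesis by simp
  qed
  have "\<gamma> ^ ?N = 1"
    using primitive_element_nonzero[OF \<gamma>] by (rule finite_field_power_card_minus_1)
  then have "\<gamma> ^ (k mod ?N) = 1"
    using k power_cong_exponent[of \<gamma> ?N "k mod ?N" k] by simp
  then have "\<gamma> ^ i = \<gamma> ^ (i mod (k mod ?N))" for i
    by (intro power_cong_exponent) auto
  then have "range (\<lambda>i::nat. \<gamma> ^ i) \<subseteq> (\<lambda>i. \<gamma> ^ i) ` {..<k mod ?N}"
    using m by (metis (no_types, lifting) image_eqI image_subsetI lessThan_iff mod_less_divisor)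
  then have "card (UNIV - {0::'a}) \<le> card {..<k mod ?N}"
    using \<gamma> unfolding primitive_element_def by (metis finite_lessThan surj_card_le)
  then have "?N \<le> k mod ?N" by (simp add: card_Diff_singleton)
  then show False using mod_less_divisor[OF N0, of k] by simp
qed

text \<open>
  Multiplication by \<open>b\<close> permutes the nonzero elements of \<open>F\<close>, so it does not change their product.
\<close>

lemma subfield_power_card_minus_1:
  fixes b :: "'a::finite_field"
  assumes F: "subfield F (ring_of_type_algebra :: 'a ring)" and b: "b \<in> F" "b \<noteq> 0"
  shows "b ^ (card F - 1) = 1"
proof -
  let ?R = "ring_of_type_algebra :: 'a ring"
  interpret R: field ?R by (rule field_from_type_algebra)
  have mult: "x * y \<in> F" if "x \<in> F" "y \<in> F" for x y
    using subringE(6)[OF subfieldE(1)[OF F] that] by simp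
  have inv: "inverse b \<in> F" using R.subfield_m_inv(1)[OF F, of b] b by simp
  have zero: "0 \<in> F" using subringE(2)[OF subfieldE(1)[OF F]] by simp
  have "(\<Prod>x\<in>F - {0}. b * x) = (\<Prod>x\<in>F - {0}. x)"
    by (rule prod.reindex_bij_witness[of _ "\<lambda>x. inverse b * x" "\<lambda>x. b * x"]) (use b mult inv in auto)
  then have "b ^ card (F - {0}) * (\<Prod>x\<in>F - {0}. x) = 1 * (\<Prod>x\<in>F - {0}. x)"
    by (simp add: prod.distrib)
  moreover have "(\<Prod>x\<in>F - {0}. x) \<noteq> 0" by simp
  ultimately show ?thesis using zero by (simp add: card_Diff_singleton)
qed

lemma power_cong_1_if_dvd_pred:
  fixes p e t :: nat
  assumes "p > 0" "e dvd p - 1"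
  shows "[p ^ t = 1] (mod e)"
proof -
  have "[p - 1 = 0] (mod e)" using assms(2) by (simp add: cong_0_iff)
  then have "[p - 1 + 1 = 0 + 1] (mod e)" by (rule cong_add) simp
  then show ?thesis using assms(1) cong_pow[of p 1 e t] by simp
qed

text \<open>
  The quotient of \<open>Q\<^sup>e - 1\<close> by \<open>Q - 1\<close> is a geometric sum with \<open>e\<close> terms, each congruent to \<open>1\<close> modulo
  \<open>e\<close>. This makes the exponent \<open>(p\<^sup>r - 1) / (e * (p\<^sup>t - 1))\<close> of \<open>\<gamma>\<close> an exact quotient.
\<close>

lemma mult_pred_dvd_pred_power:
  fixes e Q s :: nat
  assumes e: "[Q = 1] (mod e)" and Q: "Q > 0"
  shows "e * (Q - 1) dvd Q ^ (e * s) - 1"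
proof -
  have Q1: "[int Q = 1] (mod int e)" using e by (metis cong_int_iff of_nat_1)
  have "[(\<Sum>i<e. int Q ^ i) = (\<Sum>i<e. 1)] (mod int e)"
    by (rule cong_sum) (use cong_pow[OF Q1] in simp)
  then have "[(\<Sum>i<e. int Q ^ i) = int e] (mod int e)" by simp
  then have "int e dvd (\<Sum>i<e. int Q ^ i)" by (simp add: cong_dvd_iff)
  then have "int e * (int Q - 1) dvd (\<Sum>i<e. int Q ^ i) * (int Q - 1)" by (rule mult_dvd_mono) simp
  also have "\<dots> = int Q ^ e - 1" unfolding power_diff_1_eq[of "int Q" e] by (rule mult.commute)
  also have "\<dots> dvd (int Q ^ e) ^ s - 1"
    unfolding power_diff_1_eq[of "int Q ^ e" s] by (rule dvd_triv_left)
  finally have "int (e * (Q - 1)) dvd int (Q ^ (e * s) - 1)"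
    using Q by (simp add: of_nat_diff power_mult)
  then show ?thesis by (simp only: of_nat_dvd_iff)
qed

section \<open>Invariance under the subgroup of order de\<close>

text \<open>
  Since \<open>\<eta>\<close> lies in the prime field, applying the map \<open>x \<mapsto> x\<^bsup>p^t\<^esup>\<close> exactly \<open>j\<close> times multiplies \<open>a\<close> by
  \<open>\<eta>\<^sup>j\<close>, while it leaves the Kloosterman sum unchanged.
\<close>

lemma kloosterman_root_of_unity_twist:
  fixes a \<eta> :: "'a::finite_field"
  assumes p: "prime p" and card: "CARD('a) = p ^ r" and e: "e dvd p - 1" "\<eta> ^ e = 1"
    and a: "a ^ (p ^ t) = \<eta> * a"
  shows "kloosterman p r n (\<eta> ^ j * a) = kloosterman p r n a"
proof -
  have p0: "p > 0" using p by (rule prime_gt_0_nat)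
  have "[p ^ t = 1] (mod e)" using p0 e(1) by (rule power_cong_1_if_dvd_pred)
  then have \<eta>: "\<eta> ^ (p ^ t) = \<eta>" using power_cong_exponent[OF e(2), of "p ^ t" 1] by simp
  have "a ^ (p ^ (t * j)) = \<eta> ^ j * a"
  proof (induction j)
    case (Suc j)
    have "a ^ (p ^ (t * Suc j)) = (a ^ (p ^ (t * j))) ^ (p ^ t)"
      by (simp add: power_add mult.commute flip: power_mult)
    also have "\<dots> = (\<eta> ^ (p ^ t)) ^ j * a ^ (p ^ t)"
      by (simp add: Suc power_mult_distrib mult.commute[of j] flip: power_mult)
    finally show ?case by (simp add: \<eta> a mult_ac)
  qed simp
  then show ?thesis using kloosterman_frobenius_power[OF p card, of n a "t * j"] by simp
qed

theorem theorem3: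
  fixes p r n d e :: nat and \<gamma> a :: "'a::finite_field"
  assumes "prime p" and "r > 0" and "n > 0"
    and "CARD('a) = p ^ r"
    and "d = gcd (n + 1) (p - 1)"
    and "primitive_element \<gamma>"
    and "e > 1" and "e dvd gcd ((p - 1) div d) r"
    and "\<exists>t u F. t > 0 \<and> t dvd r div e \<and> u \<in> {1..e - 1} \<and> gcd e u = 1
           \<and> subfield F (ring_of_type_algebra :: 'a ring) \<and> card F = p ^ t
           \<and> a \<in> (\<lambda>b. (\<gamma> ^ ((p ^ r - 1) div (e * (p ^ t - 1)))) ^ u * b) ` (F - {0})"
  shows "kloosterman p r n a \<in> cyclotomic_subfield p (d * e)"
proof -
  note p = assms(1) and card = assms(4) and d = assms(5)
  have p0: "p > 0" using p by (rule prime_gt_0_nat)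
  from assms(9) obtain t u F where t: "t dvd r div e" and u: "gcd e u = 1"
    and F: "subfield F (ring_of_type_algebra :: 'a ring)" "card F = p ^ t"
    and aF: "a \<in> (\<lambda>b. (\<gamma> ^ ((p ^ r - 1) div (e * (p ^ t - 1)))) ^ u * b) ` (F - {0})"
    by (elim exE conjE) (rule that)
  from aF obtain b where b: "b \<in> F" "b \<noteq> 0"
    and a: "a = (\<gamma> ^ ((p ^ r - 1) div (e * (p ^ t - 1)))) ^ u * b"
    by (elim imageE DiffE) simp
  have "e dvd (p - 1) div d" "e dvd r" using assms(8) by simp_all
  moreover have dp: "d dvd p - 1" using d by simp
  moreover from calculation(1) have "e * d dvd (p - 1) div d * d" by (rule mult_dvd_mono) simp
  ultimately have de: "d * e dvd p - 1" and er: "e dvd r" by (simp_all add: mult.commute)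
  from de have ep: "e dvd p - 1" by (rule dvd_mult_right)
  have Q: "[p ^ t = 1] (mod e)" using p0 ep by (rule power_cong_1_if_dvd_pred)
  obtain s where "r div e = t * s" using t by (auto elim: dvdE)
  moreover have "r = e * (r div e)" using er by simp
  ultimately have r: "r = t * (e * s)" by (metis mult.left_commute)
  \<comment> \<open>\<open>\<gamma> ^ N\<close> is the chosen \<open>e\<close>-th root of \<open>\<gamma>\<^sub>t\<close>, and \<open>\<omega>\<close> a primitive \<open>e\<close>-th root of unity.\<close>
  define N where "N = (p ^ r - 1) div (e * (p ^ t - 1))"
  have N: "e * (p ^ t - 1) * N = p ^ r - 1"
    using mult_pred_dvd_pred_power[OF Q, of s] p0 unfolding N_def r power_mult by simp
  define \<omega> where "\<omega> = \<gamma> ^ (N * (p ^ t - 1))"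
  have \<omega>e: "\<omega> ^ e = 1"
    using finite_field_power_card_minus_1[OF primitive_element_nonzero[OF assms(6)]] N
    by (simp add: card \<omega>_def mult_ac flip: power_mult)
  have "b ^ (p ^ t - 1) = 1" using subfield_power_card_minus_1[OF F(1) b] F(2) by simp
  moreover have "((\<gamma> ^ N) ^ u) ^ (p ^ t - 1) = \<omega> ^ u"
    by (simp add: \<omega>_def mult_ac flip: power_mult)
  ultimately have "a ^ (p ^ t - 1) = \<omega> ^ u"
    by (simp only: a N_def[symmetric] power_mult_distrib mult_1_right)
  moreover have "a ^ (p ^ t) = a ^ (p ^ t - 1) * a" using p0 by (simp only: power_minus_mult zero_less_power)
  ultimately have aQ: "a ^ (p ^ t) = \<omega> ^ u * a" by simp
  have \<eta>e: "(\<omega> ^ u) ^ e = 1" using \<omega>e by (metis mult.commute power_mult power_one)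
  \<comment> \<open>As \<open>u\<close> is invertible modulo \<open>e\<close>, the powers of \<open>\<omega> ^ u\<close> include all powers of \<open>\<omega>\<close>.\<close>
  obtain v where v: "[u * v = 1] (mod e)"
    using cong_solve_coprime_nat[of u e] u by (auto simp: coprime_iff_gcd_eq_1 gcd.commute)
  have fixed: "zeta_conj p w (kloosterman p r n a) = kloosterman p r n a"
    if w: "[w ^ (d * e) = 1] (mod p)" for w
  proof -
    define c where "c = (of_nat w :: 'a)"
    have "d * e > 0" using de assms(7) d by auto
    then have nw: "\<not> p dvd w"
      using w p by (metis cong_dvd_iff dvd_power dvd_trans not_prime_unit)
    have "(of_nat (w ^ (d * e)) :: 'a) = of_nat 1"
      using w by (simp only: of_nat_eq_iff_cong_CHAR CHAR_eq[OF p card])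
    then have cde: "c ^ (d * e) = 1" by (simp add: c_def)
    obtain m where m: "n + 1 = d * m" using d by (metis dvdE gcd_dvd1)
    have "(c ^ (n + 1)) ^ e = (c ^ (d * e)) ^ m" unfolding m by (simp add: mult_ac flip: power_mult)
    then have ce: "(c ^ (n + 1)) ^ e = 1" using cde by simp
    then have "c ^ (n + 1) \<noteq> 0" using ce assms(7) by (auto simp: power_0_left)
    then obtain k where k: "c ^ (n + 1) = \<gamma> ^ k"
      using assms(6) unfolding primitive_element_def by blast
    \<comment> \<open>Comparing exponents of \<open>\<gamma>\<close> shows that this \<open>e\<close>-th root of unity is a power of \<open>\<omega>\<close>.\<close>
    have "\<gamma> ^ (k * e) = 1" using ce k by (simp add: power_mult)
    then have "e * (N * (p ^ t - 1)) dvd e * k"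
      using primitive_element_power_eq_1[OF assms(6), of "k * e"] N card by (simp add: mult_ac)
    then obtain l where l: "k = N * (p ^ t - 1) * l" using assms(7) by (auto elim: dvdE)
    have "[u * v * l = 1 * l] (mod e)" using v by (rule cong_mult) simp
    then have "\<omega> ^ (u * v * l) = \<omega> ^ l" using power_cong_exponent[OF \<omega>e] by simp
    then have "c ^ (n + 1) = (\<omega> ^ u) ^ (v * l)"
      unfolding k l by (simp add: \<omega>_def mult.assoc flip: power_mult)
    then have "kloosterman p r n (c ^ (n + 1) * a) = kloosterman p r n a"
      using kloosterman_root_of_unity_twist[OF p card ep \<eta>e aQ] by simp
    then show ?thesis using zeta_conj_kloosterman[OF p card nw] by (simp add: c_def)
  qed
  have "kloosterman p r n a \<in> cyclotomic_field p"
    unfolding kloosterman_def add_char_def by (rule sum_zeta_powers_in_cyclotomic_field)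
  then show ?thesis using cyclotomic_subfield_iff[OF p de] fixed by blast
qed

end
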